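(* Let $\{s_1,\dots,s_N\}=\{\sigma_1,\dots,\sigma_k\}\cup\{\hat\sigma_1,\dots,\hat\sigma_{N-k}\}$ and $\{p_1,\dots,p_M\}=\{\pi_1,\dots,\pi_q\}\cup\{\hat\pi_1,\dots,\hat\pi_{M-q}\}$ be disjoint partitions of two sets of distinct sampling points in $\mathbb{C}$, let $H(s_i,p_j)\in\mathbb{C}$ ($i=1,\dots,N$, $j=1,\dots,M$) be given samples, and consider the barycentric rational approximant $$\widetilde H(s,p)=\frac{n(s,p)}{d(s,p)}=\left.\sum_{i=1}^k\sum_{j=1}^q\frac{\beta_{ij}}{(s-\sigma_i)(p-\pi_j)}\right/\sum_{i=1}^k\sum_{j=1}^q\frac{\alpha_{ij}}{(s-\sigma_i)(p-\pi_j)} .$$ (a) If $\alpha_{ij}\neq 0$ and $\beta_{ij}=H(\sigma_i,\pi_j)\,\alpha_{ij}$ for all $i=1,\dots,k$, $j=1,\dots,q$, then $\widetilde H(\sigma_i,\pi_j)=H(\sigma_i,\pi_j)$ for $i=1,\dots,k$, $j=1,\dots,q$ (where $\widetilde H$ is evaluated at its removable singularity $(\sigma_i,\pi_j)$). (b) Assume $\beta_{ij}=H(\sigma_i,\pi_j)\,\alpha_{ij}$ for all $i,j$, and choose the coefficients by $$[\alpha_{11}\cdots\alpha_{1q}\mid\cdots\mid\alpha_{k1}\cdots\alpha_{kq}]^\top=\mathbf a^\star,\qquad \mathbf a^\star\in\operatorname*{arg\,min}_{\|\mathbf a\|_2=1}\|\mathbb L_2\,\mathbf a\|_2,$$ where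 $\mathbb L_2$ is the two-variable Loewner matrix defined in the context. Then $\widetilde H=n/d$ minimizes the linearized least-squares error $$\sum_{(s,p)}\bigl|H(s,p)\,d(s,p)-n(s,p)\bigr|^2,$$ where the sum runs over all sample pairs $(s,p)$ in $\{\sigma_i\}\times\{\hat\pi_\ell\}$, $\{\hat\sigma_i\}\times\{\pi_j\}$ and $\{\hat\sigma_i\}\times\{\hat\pi_\ell\}$, and the minimum is over all pairs $n,d$ of the form $n(s,p)=\sum_{i=1}^k\sum_{j=1}^q\frac{\beta_{ij}}{(s-\sigma_i)(p-\pi_j)}$, $d(s,p)=\sum_{i=1}^k\sum_{j=1}^q\frac{\alpha_{ij}}{(s-\sigma_i)(p-\pi_j)}$ (same points $\sigma_i,\pi_j$) with $\beta_{ij}=H(\sigma_i,\pi_j)\alpha_{ij}$ and $\sum_{i,j}|\alpha_{ij}|^2=1$. At pairs with $s=\sigma_i$ or $p=\pi_j$ the term $H d-n$ is understood as specified in the context.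
   Context: All $\alpha_{ij},\beta_{ij}\in\mathbb C$; $\|\cdot\|_2$ is the Euclidean norm. Definition of $\mathbb L_2\in\mathbb C^{(MN-kq)\times kq}$: $\mathbb L_2=\bigl[\mathbb L_{\sigma\hat\pi}^\top\ \ \mathbb L_{\hat\sigma\pi}^\top\ \ \mathbb L_{\hat\sigma\hat\pi}^\top\bigr]^\top$, with columns indexed by pairs $(i,j)$ ordered as $j+q(i-1)$, $i=1,\dots,k$, $j=1,\dots,q$, and blocks as follows. 1. $\mathbb L_{\hat\sigma\hat\pi}\in\mathbb C^{(N-k)(M-q)\times kq}$ has entries $$\mathbb L_{\hat\sigma\hat\pi}\bigl(\hat\jmath+(M-q)(\hat\imath-1),\,j+q(i-1)\bigr)=\frac{H(\hat\sigma_{\hat\imath},\hat\pi_{\hat\jmath})-H(\sigma_i,\pi_j)}{(\hat\sigma_{\hat\imath}-\sigma_i)(\hat\pi_{\hat\jmath}-\pi_j)},$$ for $\hat\imath=1,\dots,N-k$, $\hat\jmath=1,\dots,M-q$. 2. $\mathbb L_{\sigma\hat\pi}=\mathrm{diag}(\mathbb L_{\sigma_1},\dots,\mathbb L_{\sigma_k})\in\mathbb C^{k(M-q)\times kq}$ (block diagonal), where $\mathbb L_{\sigma_i}\in\mathbb C^{(M-q)\times q}$ has entries $(\mathbb L_{\sigma_i})_{\ell,j}=\dfrac{H(\sigma_i,\hat\pi_\ell)-H(\sigma_i,\pi_j)}{\hat\pi_\ell-\pi_j}$. 3. $\mathbb L_{\hat\sigma\pi}\in\mathbb C^{q(N-k)\times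 kq}$ is $$\mathbb L_{\hat\sigma\pi}=\left[\begin{array}{ccc|c|ccc}\mathbb L_{\pi_1}\mathbf e_1&&&&\mathbb L_{\pi_1}\mathbf e_k&&\\&\ddots&&\cdots&&\ddots&\\&&\mathbb L_{\pi_q}\mathbf e_1&&&&\mathbb L_{\pi_q}\mathbf e_k\end{array}\right],$$ where $\mathbf e_i\in\mathbb C^k$ is the $i$th unit vector and $\mathbb L_{\pi_j}\in\mathbb C^{(N-k)\times k}$ has entries $\mathbb L_{\pi_j}(\hat\imath,i)=\dfrac{H(\hat\sigma_{\hat\imath},\pi_j)-H(\sigma_i,\pi_j)}{\hat\sigma_{\hat\imath}-\sigma_i}$. Meaning of the linearized error $H d-n$ at a sample pair: - at $(\hat\sigma_{\hat\imath},\hat\pi_{\hat\jmath})$ it is $H(\hat\sigma_{\hat\imath},\hat\pi_{\hat\jmath})\,d(\hat\sigma_{\hat\imath},\hat\pi_{\hat\jmath})-n(\hat\sigma_{\hat\imath},\hat\pi_{\hat\jmath})$ literally; - at $(\sigma_i,\hat\pi_\ell)$, where $n$ and $d$ have the common polar factor $1/(s-\sigma_i)$, one uses the reduced representation $\widetilde H(\sigma_i,\hat\pi_\ell)=\left.\sum_{j}\frac{\beta_{ij}}{\hat\pi_\ell-\pi_j}\right/\sum_{j}\frac{\alpha_{ij}}{\hat\pi_\ell-\pi_j}$, i.e. $d$ and $n$ are replaced by $\sum_{j=1}^q\frac{\alpha_{ij}}{\hat\pi_\ell-\pi_j}$ and $\sum_{j=1}^q\frac{\beta_{ij}}{\hat\pi_\ell-\pi_j}$;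 - at $(\hat\sigma_{\hat\imath},\pi_j)$, similarly, $d$ and $n$ are replaced by $\sum_{i=1}^k\frac{\alpha_{ij}}{\hat\sigma_{\hat\imath}-\sigma_i}$ and $\sum_{i=1}^k\frac{\beta_{ij}}{\hat\sigma_{\hat\imath}-\sigma_i}$. *)

theory Defs
  imports Complex_Main "HOL-Analysis.L2_Norm" "Jordan_Normal_Form.Matrix"
begin

text \<open>
  All indices start at 0, so the pair \<open>(i, j)\<close> is located at position \<open>j + q * i\<close>.
  The data function \<open>H\<close> is used at pairs of sampling points only.
  Hats are written as a trailing \<open>h\<close>: \<open>\<sigma>h\<close>, \<open>\<pi>h\<close>, \<open>ih\<close>, \<open>jh\<close>.
\<close>

text \<open>
  The distinct points \<open>s 0, \<dots>, s (N - 1)\<close> are split into two disjoint groups of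
  \<open>k\<close> and \<open>N - k\<close> points. That \<open>x\<close> and \<open>y\<close> have no repetitions follows by
  counting; see \<open>disjoint_partition_inj\<close>.
\<close>
definition disjoint_partition ::
    "nat \<Rightarrow> (nat \<Rightarrow> complex) \<Rightarrow> nat \<Rightarrow> (nat \<Rightarrow> complex) \<Rightarrow> (nat \<Rightarrow> complex) \<Rightarrow> bool" where
  "disjoint_partition N s k x y \<longleftrightarrow>
     k \<le> N \<and> inj_on s {..<N} \<and>
     s ` {..<N} = x ` {..<k} \<union> y ` {..<N - k} \<and>
     x ` {..<k} \<inter> y ` {..<N - k} = {}"

lemma disjoint_partition_inj:
  assumes "disjoint_partition N s k x y"
  shows "inj_on x {..<k}" and "inj_on y {..<N - k}"
proof -
  have "N = card (x ` {..<k} \<union> y ` {..<N - k})"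
    using assms unfolding disjoint_partition_def by (metis card_image card_lessThan)
  also have "\<dots> = card (x ` {..<k}) + card (y ` {..<N - k})"
    using assms unfolding disjoint_partition_def by (intro card_Un_disjoint) auto
  finally have "N = card (x ` {..<k}) + card (y ` {..<N - k})" .
  moreover have "card (x ` {..<k}) \<le> k" "card (y ` {..<N - k}) \<le> N - k"
    using card_image_le[of "{..<k}" x] card_image_le[of "{..<N - k}" y] by auto
  moreover have "k \<le> N" using assms by (simp add: disjoint_partition_def)
  ultimately have "card (x ` {..<k}) = card {..<k}" "card (y ` {..<N - k}) = card {..<N - k}"
    by auto
  then show "inj_on x {..<k}" "inj_on y {..<N - k}"
    by (auto intro: eq_card_imp_inj_on)
qed


subsection \<open>The barycentric rational approximant\<close>

text \<open>The common form of \<open>n\<close> (coefficients \<open>\<beta>\<close>) and \<open>d\<close> (coefficients \<open>\<alpha>\<close>).\<close>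
definition bary_sum ::
    "nat \<Rightarrow> nat \<Rightarrow> (nat \<Rightarrow> complex) \<Rightarrow> (nat \<Rightarrow> complex) \<Rightarrow> (nat \<Rightarrow> nat \<Rightarrow> complex) \<Rightarrow>
     complex \<Rightarrow> complex \<Rightarrow> complex" where
  "bary_sum k q \<sigma> \<pi> c s p = (\<Sum>i<k. \<Sum>j<q. c i j / ((s - \<sigma> i) * (p - \<pi> j)))"

definition bary_quot ::
    "nat \<Rightarrow> nat \<Rightarrow> (nat \<Rightarrow> complex) \<Rightarrow> (nat \<Rightarrow> complex) \<Rightarrow> (nat \<Rightarrow> nat \<Rightarrow> complex) \<Rightarrow>
     (nat \<Rightarrow> nat \<Rightarrow> complex) \<Rightarrow> complex \<times> complex \<Rightarrow> complex" where
  "bary_quot k q \<sigma> \<pi> \<alpha> \<beta> = (\<lambda>(s, p). bary_sum k q \<sigma> \<pi> \<beta> s p / bary_sum k q \<sigma> \<pi> \<alpha> s p)"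

text \<open>
  Where the quotient \<open>n / d\<close> is literally meaningful. Outside this set \<open>bary_quot\<close> has
  spurious values, since \<open>x / 0 = 0\<close>.
\<close>
definition bary_domain ::
    "nat \<Rightarrow> nat \<Rightarrow> (nat \<Rightarrow> complex) \<Rightarrow> (nat \<Rightarrow> complex) \<Rightarrow> (nat \<Rightarrow> nat \<Rightarrow> complex) \<Rightarrow>
     (complex \<times> complex) set" where
  "bary_domain k q \<sigma> \<pi> \<alpha> =
     {(s, p). s \<notin> \<sigma> ` {..<k} \<and> p \<notin> \<pi> ` {..<q} \<and> bary_sum k q \<sigma> \<pi> \<alpha> s p \<noteq> 0}"

text \<open>
  The approximant, extended to removable singularities by its limit along the domain.
  At a point where that limit does not exist the value is unspecified.
\<close>
definition bary_approx ::
    "nat \<Rightarrow> nat \<Rightarrow> (nat \<Rightarrow> complex) \<Rightarrow> (nat \<Rightarrow> complex) \<Rightarrow> (nat \<Rightarrow> nat \<Rightarrow> complex) \<Rightarrow>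
     (nat \<Rightarrow> nat \<Rightarrow> complex) \<Rightarrow> complex \<times> complex \<Rightarrow> complex" where
  "bary_approx k q \<sigma> \<pi> \<alpha> \<beta> z =
     (if z \<in> bary_domain k q \<sigma> \<pi> \<alpha> then bary_quot k q \<sigma> \<pi> \<alpha> \<beta> z
      else Lim (at z within bary_domain k q \<sigma> \<pi> \<alpha>) (bary_quot k q \<sigma> \<pi> \<alpha> \<beta>))"


subsection \<open>The two-variable Loewner matrix\<close>

definition loewner_sigma ::
    "(complex \<Rightarrow> complex \<Rightarrow> complex) \<Rightarrow> nat \<Rightarrow> nat \<Rightarrow> (nat \<Rightarrow> complex) \<Rightarrow> (nat \<Rightarrow> complex) \<Rightarrow>
     complex \<Rightarrow> complex mat" where
  "loewner_sigma H M q \<pi> \<pi>h \<sigma>i =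
     mat (M - q) q (\<lambda>(l, j). (H \<sigma>i (\<pi>h l) - H \<sigma>i (\<pi> j)) / (\<pi>h l - \<pi> j))"

definition loewner_pi ::
    "(complex \<Rightarrow> complex \<Rightarrow> complex) \<Rightarrow> nat \<Rightarrow> nat \<Rightarrow> (nat \<Rightarrow> complex) \<Rightarrow> (nat \<Rightarrow> complex) \<Rightarrow>
     complex \<Rightarrow> complex mat" where
  "loewner_pi H N k \<sigma> \<sigma>h \<pi>j =
     mat (N - k) k (\<lambda>(ih, i). (H (\<sigma>h ih) \<pi>j - H (\<sigma> i) \<pi>j) / (\<sigma>h ih - \<sigma> i))"

definition loewner_sigma_pih ::
    "(complex \<Rightarrow> complex \<Rightarrow> complex) \<Rightarrow> nat \<Rightarrow> nat \<Rightarrow> nat \<Rightarrow> (nat \<Rightarrow> complex) \<Rightarrow>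
     (nat \<Rightarrow> complex) \<Rightarrow> (nat \<Rightarrow> complex) \<Rightarrow> complex mat" where
  "loewner_sigma_pih H M k q \<sigma> \<pi> \<pi>h =
     diag_block_mat (map (\<lambda>i. loewner_sigma H M q \<pi> \<pi>h (\<sigma> i)) [0..<k])"

text \<open>
  \<open>k\<close> blocks side by side; column \<open>j + q * i\<close> is column \<open>j\<close> of the \<open>i\<close>-th block, which
  is the block diagonal matrix with the column vectors \<open>loewner_pi (\<pi> j) e\<^sub>i\<close>, \<open>j < q\<close>,
  as its diagonal blocks.
\<close>
definition loewner_sigmah_pi ::
    "(complex \<Rightarrow> complex \<Rightarrow> complex) \<Rightarrow> nat \<Rightarrow> nat \<Rightarrow> nat \<Rightarrow> (nat \<Rightarrow> complex) \<Rightarrow>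
     (nat \<Rightarrow> complex) \<Rightarrow> (nat \<Rightarrow> complex) \<Rightarrow> complex mat" where
  "loewner_sigmah_pi H N k q \<sigma> \<sigma>h \<pi> =
     mat (q * (N - k)) (k * q) (\<lambda>(r, c).
       diag_block_mat
         (map (\<lambda>j. mat_of_cols (N - k)
                     [loewner_pi H N k \<sigma> \<sigma>h (\<pi> j) *\<^sub>v unit_vec k (c div q)]) [0..<q])
       $$ (r, c mod q))"

definition loewner_sigmah_pih ::
    "(complex \<Rightarrow> complex \<Rightarrow> complex) \<Rightarrow> nat \<Rightarrow> nat \<Rightarrow> nat \<Rightarrow> nat \<Rightarrow> (nat \<Rightarrow> complex) \<Rightarrow>
     (nat \<Rightarrow> complex) \<Rightarrow> (nat \<Rightarrow> complex) \<Rightarrow> (nat \<Rightarrow> complex) \<Rightarrow> complex mat" where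
  "loewner_sigmah_pih H N M k q \<sigma> \<sigma>h \<pi> \<pi>h =
     mat ((N - k) * (M - q)) (k * q) (\<lambda>(r, c).
       let ih = r div (M - q); jh = r mod (M - q); i = c div q; j = c mod q
       in (H (\<sigma>h ih) (\<pi>h jh) - H (\<sigma> i) (\<pi> j)) / ((\<sigma>h ih - \<sigma> i) * (\<pi>h jh - \<pi> j)))"

definition loewner2 ::
    "(complex \<Rightarrow> complex \<Rightarrow> complex) \<Rightarrow> nat \<Rightarrow> nat \<Rightarrow> nat \<Rightarrow> nat \<Rightarrow> (nat \<Rightarrow> complex) \<Rightarrow>
     (nat \<Rightarrow> complex) \<Rightarrow> (nat \<Rightarrow> complex) \<Rightarrow> (nat \<Rightarrow> complex) \<Rightarrow> complex mat" where
  "loewner2 H N M k q \<sigma> \<sigma>h \<pi> \<pi>h =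
     loewner_sigma_pih H M k q \<sigma> \<pi> \<pi>h
     @\<^sub>r loewner_sigmah_pi H N k q \<sigma> \<sigma>h \<pi>
     @\<^sub>r loewner_sigmah_pih H N M k q \<sigma> \<sigma>h \<pi> \<pi>h"

definition norm2 :: "complex vec \<Rightarrow> real" where
  "norm2 v = L2_set (\<lambda>i. cmod (v $ i)) {..<dim_vec v}"


subsection \<open>The linearized least-squares error\<close>

text \<open>
  At \<open>(\<sigma> i, \<pi>h l)\<close> and \<open>(\<sigma>h ih, \<pi> j)\<close> the common polar factor of \<open>n\<close> and \<open>d\<close> is
  dropped, leaving the following one-variable barycentric sums.
\<close>
definition bary_sum_sigma ::
    "nat \<Rightarrow> (nat \<Rightarrow> complex) \<Rightarrow> (nat \<Rightarrow> nat \<Rightarrow> complex) \<Rightarrow> nat \<Rightarrow> complex \<Rightarrow> complex" where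
  "bary_sum_sigma q \<pi> c i p = (\<Sum>j<q. c i j / (p - \<pi> j))"

definition bary_sum_pi ::
    "nat \<Rightarrow> (nat \<Rightarrow> complex) \<Rightarrow> (nat \<Rightarrow> nat \<Rightarrow> complex) \<Rightarrow> nat \<Rightarrow> complex \<Rightarrow> complex" where
  "bary_sum_pi k \<sigma> c j s = (\<Sum>i<k. c i j / (s - \<sigma> i))"

definition linearized_error ::
    "(complex \<Rightarrow> complex \<Rightarrow> complex) \<Rightarrow> nat \<Rightarrow> nat \<Rightarrow> nat \<Rightarrow> nat \<Rightarrow> (nat \<Rightarrow> complex) \<Rightarrow>
     (nat \<Rightarrow> complex) \<Rightarrow> (nat \<Rightarrow> complex) \<Rightarrow> (nat \<Rightarrow> complex) \<Rightarrow>
     (nat \<Rightarrow> nat \<Rightarrow> complex) \<Rightarrow> (nat \<Rightarrow> nat \<Rightarrow> complex) \<Rightarrow> real" where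
  "linearized_error H N M k q \<sigma> \<sigma>h \<pi> \<pi>h \<alpha> \<beta> =
     (\<Sum>i<k. \<Sum>l<M - q.
        (cmod (H (\<sigma> i) (\<pi>h l) * bary_sum_sigma q \<pi> \<alpha> i (\<pi>h l)
               - bary_sum_sigma q \<pi> \<beta> i (\<pi>h l)))\<^sup>2)
   + (\<Sum>ih<N - k. \<Sum>j<q.
        (cmod (H (\<sigma>h ih) (\<pi> j) * bary_sum_pi k \<sigma> \<alpha> j (\<sigma>h ih)
               - bary_sum_pi k \<sigma> \<beta> j (\<sigma>h ih)))\<^sup>2)
   + (\<Sum>ih<N - k. \<Sum>jh<M - q.
        (cmod (H (\<sigma>h ih) (\<pi>h jh) * bary_sum k q \<sigma> \<pi> \<alpha> (\<sigma>h ih) (\<pi>h jh)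
               - bary_sum k q \<sigma> \<pi> \<beta> (\<sigma>h ih) (\<pi>h jh)))\<^sup>2)"

end

theory Submission
  imports Defs
begin

text \<open>
  Multiplying \<open>n\<close> and \<open>d\<close> by \<open>(s - \<sigma>\<^sub>i) (p - \<pi>\<^sub>j)\<close> removes the polar factors near
  \<open>(\<sigma>\<^sub>i, \<pi>\<^sub>j)\<close>, and the resulting sums tend to \<open>\<beta>\<^sub>i\<^sub>j\<close> and \<open>\<alpha>\<^sub>i\<^sub>j\<close>; this is (a). For (b), the rows of
  the Loewner matrix are indexed by the sample pairs outside \<open>{\<sigma>\<^sub>i} \<times> {\<pi>\<^sub>j}\<close>, and the entry of
  \<open>\<L>\<^sub>2 a\<close> in each row is the value of \<open>H d - n\<close> at that pair, so the linearized error is the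
  squared norm of \<open>\<L>\<^sub>2 a\<close>.
\<close>

subsection \<open>Interpolation\<close>

text \<open>The quotient for \<open>m = i\<close> would be 0 / 0 = 0 at \<open>t = x i\<close>.
  Fixing the value 1 there makes the factor continuous at the node, so its limit exists along every
  filter tending to it.\<close>

definition cleared_factor :: "(nat \<Rightarrow> complex) \<Rightarrow> nat \<Rightarrow> nat \<Rightarrow> complex \<Rightarrow> complex" where
  "cleared_factor x i m t = (if m = i then 1 else (t - x i) / (t - x m))"

lemma cleared_factor_eq:
  assumes "t \<noteq> x i"
  shows "cleared_factor x i m t = (t - x i) / (t - x m)"
  using assms by (simp add: cleared_factor_def)

lemma tendsto_cleared_factor:
  assumes "(f \<longlongrightarrow> x i) F" "inj_on x {..<n}" "i < n" "m < n"
  shows "((\<lambda>z. cleared_factor x i m (f z)) \<longlongrightarrow> of_bool (m = i)) F"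
proof (cases "m = i")
  case False
  then have "x i - x m \<noteq> 0" using assms by (auto dest: inj_onD)
  then have "((\<lambda>z. (f z - x i) / (f z - x m)) \<longlongrightarrow> (x i - x i) / (x i - x m)) F"
    by (intro tendsto_intros assms)
  with False show ?thesis by (simp add: cleared_factor_def)
qed (simp add: cleared_factor_def)

definition cleared_sum ::
    "nat \<Rightarrow> nat \<Rightarrow> (nat \<Rightarrow> complex) \<Rightarrow> (nat \<Rightarrow> complex) \<Rightarrow> (nat \<Rightarrow> nat \<Rightarrow> complex) \<Rightarrow>
     nat \<Rightarrow> nat \<Rightarrow> complex \<Rightarrow> complex \<Rightarrow> complex" where
  "cleared_sum k q \<sigma> \<pi> c i j s p =
     (\<Sum>m<k. \<Sum>n<q. c m n * cleared_factor \<sigma> i m s * cleared_factor \<pi> j n p)"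

lemma cleared_sum_eq:
  assumes "s \<noteq> \<sigma> i" "p \<noteq> \<pi> j"
  shows "cleared_sum k q \<sigma> \<pi> c i j s p = (s - \<sigma> i) * (p - \<pi> j) * bary_sum k q \<sigma> \<pi> c s p"
  using assms
  by (simp add: cleared_sum_def bary_sum_def cleared_factor_eq sum_distrib_left mult_ac)

text \<open>The factors tend to 0 or 1, and both tend to 1 only in the term with indices
  \<open>i\<close>, \<open>j\<close>. The maps \<open>f\<close>, \<open>g\<close> and the filter
  stay general because two approaches to the node are used: through the two-variable domain and
  along a single path.\<close>

lemma tendsto_cleared_sum:
  assumes "(f \<longlongrightarrow> \<sigma> i) F" "(g \<longlongrightarrow> \<pi> j) F"
    and "inj_on \<sigma> {..<k}" "inj_on \<pi> {..<q}" "i < k" "j < q"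
  shows "((\<lambda>z. cleared_sum k q \<sigma> \<pi> c i j (f z) (g z)) \<longlongrightarrow> c i j) F"
proof -
  have "((\<lambda>z. cleared_sum k q \<sigma> \<pi> c i j (f z) (g z)) \<longlongrightarrow>
          (\<Sum>m<k. \<Sum>n<q. c m n * of_bool (m = i) * of_bool (n = j))) F"
    unfolding cleared_sum_def
    by (intro tendsto_sum tendsto_mult tendsto_const tendsto_cleared_factor[where n = k]
        tendsto_cleared_factor[where n = q]) (use assms in auto)
  also have "(\<Sum>m<k. \<Sum>n<q. c m n * of_bool (m = i) * of_bool (n = j)) =
      (\<Sum>m<k. of_bool (m = i) * c m j)"
    using \<open>j < q\<close> by (intro sum.cong) (auto simp: of_bool_def if_distrib cong: if_cong)
  also have "\<dots> = c i j"
    using \<open>i < k\<close> by (simp add: of_bool_def if_distrib if_distribR cong: if_cong)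
  finally show ?thesis .
qed

lemma tendsto_bary_quot:
  assumes "inj_on \<sigma> {..<k}" "inj_on \<pi> {..<q}" "i < k" "j < q" "\<alpha> i j \<noteq> 0"
  shows "(bary_quot k q \<sigma> \<pi> \<alpha> \<beta> \<longlongrightarrow> \<beta> i j / \<alpha> i j)
           (at (\<sigma> i, \<pi> j) within bary_domain k q \<sigma> \<pi> \<alpha>)"
proof -
  let ?F = "at (\<sigma> i, \<pi> j) within bary_domain k q \<sigma> \<pi> \<alpha>"
  let ?c = "\<lambda>c z. cleared_sum k q \<sigma> \<pi> c i j (fst z) (snd z)"
  have "((\<lambda>z. z) \<longlongrightarrow> (\<sigma> i, \<pi> j)) ?F" by (rule tendsto_ident_at)
  from tendsto_fst[OF this] tendsto_snd[OF this]
  have *: "(?c c \<longlongrightarrow> c i j) ?F" for c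
    by (intro tendsto_cleared_sum assms) simp_all
  have "((\<lambda>z. ?c \<beta> z / ?c \<alpha> z) \<longlongrightarrow> \<beta> i j / \<alpha> i j) ?F"
    by (intro tendsto_divide * assms)
  \<comment> \<open>Both coordinates of a domain point avoid the nodes, so the clearing factor is
    nonzero and cancels from the quotient.\<close>
  moreover have "\<forall>\<^sub>F z in ?F. ?c \<beta> z / ?c \<alpha> z = bary_quot k q \<sigma> \<pi> \<alpha> \<beta> z"
    unfolding eventually_at_filter
  proof (intro always_eventually allI impI)
    fix z assume "z \<in> bary_domain k q \<sigma> \<pi> \<alpha>"
    then have "fst z \<noteq> \<sigma> i" "snd z \<noteq> \<pi> j"
      using assms(3,4) by (auto simp: bary_domain_def)
    then show "?c \<beta> z / ?c \<alpha> z = bary_quot k q \<sigma> \<pi> \<alpha> \<beta> z"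
      by (simp add: cleared_sum_eq bary_quot_def split_beta)
  qed
  ultimately show ?thesis by (rule Lim_transform_eventually)
qed

text \<open>The set \<open>S - {x}\<close> is finite, hence closed, so its complement is a
  neighbourhood of \<open>x\<close>; the point \<open>x\<close> itself is excluded by the punctured
  filter.\<close>

lemma eventually_add_notin_finite:
  fixes x :: complex
  assumes "finite S"
  shows "\<forall>\<^sub>F t in at 0. x + t \<notin> S"
proof -
  have "open (- (S - {x}))" using assms by (intro open_Compl finite_imp_closed) auto
  then have "\<forall>\<^sub>F t in at x. t \<notin> S"
    unfolding eventually_at_topological by (intro exI[of _ "- (S - {x})"]) auto
  then show ?thesis by (simp add: eventually_at_to_0[of _ x] add.commute)
qed

text \<open>Without this the limit in \<open>bary_approx\<close> would be taken along a trivial filter.\<close>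
lemma at_within_bary_domain_neq_bot:
  assumes "inj_on \<sigma> {..<k}" "inj_on \<pi> {..<q}" "i < k" "j < q" "\<alpha> i j \<noteq> 0"
  shows "at (\<sigma> i, \<pi> j) within bary_domain k q \<sigma> \<pi> \<alpha> \<noteq> bot"
proof -
  \<comment> \<open>A diagonal path into the node. For small nonzero \<open>t\<close> it avoids the
    finitely many polar lines, and the cleared denominator is nonzero because its limit is
    \<open>\<alpha> i j\<close>.\<close>
  let ?z = "\<lambda>t. (\<sigma> i + t, \<pi> j + t)"
  have \<sigma>: "((\<lambda>t. \<sigma> i + t) \<longlongrightarrow> \<sigma> i) (at 0)" and \<pi>: "((\<lambda>t. \<pi> j + t) \<longlongrightarrow> \<pi> j) (at 0)"
    by (auto intro!: tendsto_eq_intros)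
  have "((\<lambda>t. cleared_sum k q \<sigma> \<pi> \<alpha> i j (\<sigma> i + t) (\<pi> j + t)) \<longlongrightarrow> \<alpha> i j) (at 0)"
    by (intro tendsto_cleared_sum \<sigma> \<pi> assms)
  then have "\<forall>\<^sub>F t in at 0. cleared_sum k q \<sigma> \<pi> \<alpha> i j (\<sigma> i + t) (\<pi> j + t) \<noteq> 0"
    using \<open>\<alpha> i j \<noteq> 0\<close> by (rule tendsto_imp_eventually_ne)
  moreover have "\<forall>\<^sub>F t in at 0. \<sigma> i + t \<notin> \<sigma> ` {..<k}" "\<forall>\<^sub>F t in at 0. \<pi> j + t \<notin> \<pi> ` {..<q}"
    by (auto intro: eventually_add_notin_finite)
  ultimately have "\<forall>\<^sub>F t in at 0. ?z t \<in> bary_domain k q \<sigma> \<pi> \<alpha> \<and> ?z t \<noteq> (\<sigma> i, \<pi> j)"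
  proof eventually_elim
    case (elim t)
    then have "t \<noteq> 0" using assms(3) by auto
    with elim show ?case by (auto simp: bary_domain_def cleared_sum_eq)
  qed
  then have "filterlim ?z (at (\<sigma> i, \<pi> j) within bary_domain k q \<sigma> \<pi> \<alpha>) (at 0)"
    by (simp add: filterlim_at tendsto_Pair[OF \<sigma> \<pi>])
  \<comment> \<open>If the target filter were \<open>bot\<close>, the image of \<open>at 0\<close>
    under the path would be \<open>bot\<close> as well, although \<open>at 0\<close> is nontrivial
    in the complex plane.\<close>
  then show ?thesis
    by (auto simp: filterlim_def filtermap_bot_iff bot_unique)
qed

text \<open>A node lies outside the domain, so the value is the \<open>Lim\<close> branch;
  nontriviality of the filter makes the limit unique.\<close>

lemma bary_approx_node:
  assumes "inj_on \<sigma> {..<k}" "inj_on \<pi> {..<q}" "i < k" "j < q" "\<alpha> i j \<noteq> 0"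
  shows "bary_approx k q \<sigma> \<pi> \<alpha> \<beta> (\<sigma> i, \<pi> j) = \<beta> i j / \<alpha> i j"
proof -
  have "(\<sigma> i, \<pi> j) \<notin> bary_domain k q \<sigma> \<pi> \<alpha>"
    using assms(3) by (simp add: bary_domain_def)
  then show ?thesis
    using tendsto_Lim[OF at_within_bary_domain_neq_bot[where \<alpha> = \<alpha>, OF assms]
        tendsto_bary_quot[where \<alpha> = \<alpha> and \<beta> = \<beta>, OF assms]]
    by (simp add: bary_approx_def)
qed


subsection \<open>Block matrices and Euclidean norms\<close>

lemma mult_add_less:
  fixes i j m n :: nat
  assumes "i < m" "j < n"
  shows "j + n * i < m * n"
proof -
  have "j + n * i < n * Suc i" using assms by simp
  also have "\<dots> \<le> n * m" using assms by (intro mult_le_mono) auto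
  finally show ?thesis by (simp add: mult.commute)
qed

text \<open>Division with remainder by \<open>n\<close>. This turns flat vector indices into index
  pairs, both for the columns of the Loewner matrix and for the rows of each block.\<close>

lemma sum_lessThan_mult:
  fixes f :: "nat \<Rightarrow> 'a::comm_monoid_add"
  shows "sum f {..<m * n} = (\<Sum>i<m. \<Sum>j<n. f (j + n * i))"
  by (simp add: sum.nat_group[symmetric] sum.atLeastLessThan_shift_0[of f "_ * n"]
      atLeast0LessThan mult.commute add.commute)

lemma diag_block_mat_uniform_carrier:
  assumes "\<forall>A\<in>set As. A \<in> carrier_mat r c"
  shows "diag_block_mat As \<in> carrier_mat (length As * r) (length As * c)"
  using assms by (induction As) (auto simp: Let_def)

text \<open>With blocks of equal size, \<open>div\<close> finds the block and \<open>mod\<close> the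
  position inside it. Peeling off the first block lowers both quotients by one and keeps the
  remainders.\<close>

lemma diag_block_mat_uniform_index:
  assumes "\<forall>A\<in>set As. A \<in> carrier_mat r c" "a < length As * r" "b < length As * c"
  shows "diag_block_mat As $$ (a, b) =
    (if a div r = b div c then (As ! (a div r)) $$ (a mod r, b mod c) else 0)"
  using assms
proof (induction As arbitrary: a b)
  case (Cons A As)
  have A: "A \<in> carrier_mat r c" and As: "\<forall>A\<in>set As. A \<in> carrier_mat r c"
    using Cons.prems by auto
  have dims: "dim_row (diag_block_mat As) = length As * r" "dim_col (diag_block_mat As) = length As * c"
    using diag_block_mat_uniform_carrier[OF As] by auto
  \<comment> \<open>Existing indices exclude empty blocks, for which \<open>div\<close> would be
    division by 0.\<close>
  have pos: "0 < r" "0 < c" using Cons.prems(2,3) by (auto intro: Nat.gr0I)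
  have "diag_block_mat (A # As) $$ (a, b) =
      (if a < r then if b < c then A $$ (a, b) else 0
       else if b < c then 0 else diag_block_mat As $$ (a - r, b - c))"
    using A dims Cons.prems(2,3) by (auto simp: Let_def)
  moreover have "diag_block_mat As $$ (a - r, b - c) =
      (if (a - r) div r = (b - c) div c
       then (As ! ((a - r) div r)) $$ ((a - r) mod r, (b - c) mod c) else 0)"
    if "\<not> a < r" "\<not> b < c"
    using that Cons.prems(2,3) by (intro Cons.IH As) auto
  ultimately show ?case
    using pos by (auto simp: le_div_geq le_mod_geq not_less div_eq_0_iff)
qed simp

lemma norm2_squared: "(norm2 v)\<^sup>2 = (\<Sum>i<dim_vec v. (cmod (v $ i))\<^sup>2)"
  by (simp add: norm2_def L2_set_def sum_nonneg)

lemma norm2_nonneg: "0 \<le> norm2 v"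
  by (simp add: norm2_def)

lemma norm2_append_squared: "(norm2 (u @\<^sub>v v))\<^sup>2 = (norm2 u)\<^sup>2 + (norm2 v)\<^sup>2"
proof -
  have *: "{..<dim_vec u + dim_vec v} = {..<dim_vec u} \<union> {dim_vec u..<dim_vec u + dim_vec v}"
    by auto
  have "(norm2 (u @\<^sub>v v))\<^sup>2 = (\<Sum>i<dim_vec u. (cmod ((u @\<^sub>v v) $ i))\<^sup>2)
      + (\<Sum>i=dim_vec u..<dim_vec u + dim_vec v. (cmod ((u @\<^sub>v v) $ i))\<^sup>2)"
    unfolding norm2_squared index_append_vec(2) * by (rule sum.union_disjoint) auto
  also have "(\<Sum>i=dim_vec u..<dim_vec u + dim_vec v. (cmod ((u @\<^sub>v v) $ i))\<^sup>2) = (norm2 v)\<^sup>2"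
    unfolding norm2_squared
    by (rule sum.reindex_bij_witness[of _ "\<lambda>i. i + dim_vec u" "\<lambda>i. i - dim_vec u"]) auto
  finally show ?thesis by (simp add: norm2_squared)
qed

lemma index_mult_mat_vec_pairs:
  assumes "A \<in> carrier_mat r (k * q)" "v \<in> carrier_vec (k * q)" "t < r"
  shows "(A *\<^sub>v v) $ t = (\<Sum>i<k. \<Sum>j<q. A $$ (t, j + q * i) * v $ (j + q * i))"
proof -
  have "(A *\<^sub>v v) $ t = (\<Sum>c<k * q. A $$ (t, c) * v $ c)"
    using assms by (auto simp: scalar_prod_def atLeast0LessThan intro!: sum.cong)
  then show ?thesis by (simp add: sum_lessThan_mult)
qed

lemma norm2_pairs_squared:
  assumes "v \<in> carrier_vec (m * n)"
  shows "(norm2 v)\<^sup>2 = (\<Sum>i<m. \<Sum>j<n. (cmod (v $ (j + n * i)))\<^sup>2)"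
  using assms by (simp add: norm2_squared sum_lessThan_mult)


subsection \<open>The Loewner matrix and the linearized error\<close>

lemma loewner_sigma_pih_carrier:
  "loewner_sigma_pih H M k q \<sigma> \<pi> \<pi>h \<in> carrier_mat (k * (M - q)) (k * q)"
  using diag_block_mat_uniform_carrier[of "map (\<lambda>i. loewner_sigma H M q \<pi> \<pi>h (\<sigma> i)) [0..<k]" "M - q" q]
  by (simp add: loewner_sigma_pih_def loewner_sigma_def)

lemma loewner_sigma_pih_index:
  assumes "i < k" "l < M - q" "m < k" "j < q"
  shows "loewner_sigma_pih H M k q \<sigma> \<pi> \<pi>h $$ (l + (M - q) * i, j + q * m) =
    (if i = m then (H (\<sigma> i) (\<pi>h l) - H (\<sigma> i) (\<pi> j)) / (\<pi>h l - \<pi> j) else 0)"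
  unfolding loewner_sigma_pih_def
  using assms mult_add_less[of i k l "M - q"] mult_add_less[of m k j q]
  by (subst diag_block_mat_uniform_index[where r = "M - q" and c = q])
    (auto simp: loewner_sigma_def)

lemma loewner_sigmah_pi_carrier:
  "loewner_sigmah_pi H N k q \<sigma> \<sigma>h \<pi> \<in> carrier_mat (q * (N - k)) (k * q)"
  by (simp add: loewner_sigmah_pi_def)

text \<open>Within the column group of a fixed \<open>i\<close> the matrix is block diagonal with
  blocks of width 1, so the uniform block lemma applies with \<open>c = 1\<close>; the unit vector
  selects column \<open>i\<close> of \<open>loewner_pi\<close>.\<close>

lemma loewner_sigmah_pi_index:
  assumes "j < q" "ih < N - k" "i < k" "n < q"
  shows "loewner_sigmah_pi H N k q \<sigma> \<sigma>h \<pi> $$ (ih + (N - k) * j, n + q * i) =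
    (if j = n then (H (\<sigma>h ih) (\<pi> j) - H (\<sigma> i) (\<pi> j)) / (\<sigma>h ih - \<sigma> i) else 0)"
proof -
  let ?A = "\<lambda>j. mat_of_cols (N - k) [loewner_pi H N k \<sigma> \<sigma>h (\<pi> j) *\<^sub>v unit_vec k i]"
  have "diag_block_mat (map ?A [0..<q]) $$ (ih + (N - k) * j, n) =
      (if j = n then ?A j $$ (ih, 0) else 0)"
    using assms mult_add_less[of j q ih "N - k"]
    by (subst diag_block_mat_uniform_index[where r = "N - k" and c = 1]) auto
  moreover have "?A j $$ (ih, 0) = (H (\<sigma>h ih) (\<pi> j) - H (\<sigma> i) (\<pi> j)) / (\<sigma>h ih - \<sigma> i)"
    using assms by (simp add: mat_of_cols_index loewner_pi_def)
  ultimately show ?thesis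
    using assms mult_add_less[of j q ih "N - k"] mult_add_less[of i k n q]
    by (auto simp: loewner_sigmah_pi_def)
qed

lemma loewner_sigmah_pih_carrier:
  "loewner_sigmah_pih H N M k q \<sigma> \<sigma>h \<pi> \<pi>h \<in> carrier_mat ((N - k) * (M - q)) (k * q)"
  by (simp add: loewner_sigmah_pih_def)

lemma loewner_sigmah_pih_index:
  assumes "ih < N - k" "jh < M - q" "i < k" "j < q"
  shows "loewner_sigmah_pih H N M k q \<sigma> \<sigma>h \<pi> \<pi>h $$ (jh + (M - q) * ih, j + q * i) =
    (H (\<sigma>h ih) (\<pi>h jh) - H (\<sigma> i) (\<pi> j)) / ((\<sigma>h ih - \<sigma> i) * (\<pi>h jh - \<pi> j))"
  using assms mult_add_less[of ih "N - k" jh "M - q"] mult_add_less[of i k j q]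
  by (simp add: loewner_sigmah_pih_def)

text \<open>Stated for an arbitrary coefficient vector, so that it applies to the minimizer and to
  each competitor alike.\<close>

lemma norm2_loewner2_squared:
  assumes \<beta>: "\<forall>i<k. \<forall>j<q. \<beta> i j = H (\<sigma> i) (\<pi> j) * \<alpha> i j"
    and v: "v \<in> carrier_vec (k * q)"
    and \<alpha>: "\<forall>i<k. \<forall>j<q. \<alpha> i j = v $ (j + q * i)"
  shows "(norm2 (loewner2 H N M k q \<sigma> \<sigma>h \<pi> \<pi>h *\<^sub>v v))\<^sup>2 =
    linearized_error H N M k q \<sigma> \<sigma>h \<pi> \<pi>h \<alpha> \<beta>"
proof -
  let ?A = "loewner_sigma_pih H M k q \<sigma> \<pi> \<pi>h"
  let ?B = "loewner_sigmah_pi H N k q \<sigma> \<sigma>h \<pi>"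
  let ?C = "loewner_sigmah_pih H N M k q \<sigma> \<sigma>h \<pi> \<pi>h"
  note A = loewner_sigma_pih_carrier[of H M k q \<sigma> \<pi> \<pi>h]
  note B = loewner_sigmah_pi_carrier[of H N k q \<sigma> \<sigma>h \<pi>]
  note C = loewner_sigmah_pih_carrier[of H N M k q \<sigma> \<sigma>h \<pi> \<pi>h]
  have "loewner2 H N M k q \<sigma> \<sigma>h \<pi> \<pi>h *\<^sub>v v = (?A *\<^sub>v v) @\<^sub>v (?B *\<^sub>v v) @\<^sub>v (?C *\<^sub>v v)"
    unfolding loewner2_def
    by (simp add: mat_mult_append[OF A carrier_append_rows[OF B C] v] mat_mult_append[OF B C v])
  then have split: "(norm2 (loewner2 H N M k q \<sigma> \<sigma>h \<pi> \<pi>h *\<^sub>v v))\<^sup>2 =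
      (norm2 (?A *\<^sub>v v))\<^sup>2 + (norm2 (?B *\<^sub>v v))\<^sup>2 + (norm2 (?C *\<^sub>v v))\<^sup>2"
    by (simp add: norm2_append_squared)
  have rowA: "(?A *\<^sub>v v) $ (l + (M - q) * i) =
      H (\<sigma> i) (\<pi>h l) * bary_sum_sigma q \<pi> \<alpha> i (\<pi>h l) - bary_sum_sigma q \<pi> \<beta> i (\<pi>h l)"
    if "i < k" "l < M - q" for i l
  proof -
    \<comment> \<open>Block diagonality leaves only the column group \<open>m = i\<close>.\<close>
    have "(?A *\<^sub>v v) $ (l + (M - q) * i) = (\<Sum>m<k. \<Sum>j<q. if i = m
        then (H (\<sigma> i) (\<pi>h l) - H (\<sigma> i) (\<pi> j)) / (\<pi>h l - \<pi> j) * \<alpha> i j else 0)"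
      unfolding index_mult_mat_vec_pairs[OF A v mult_add_less[OF that]]
      using that \<alpha> by (intro sum.cong refl) (auto simp: loewner_sigma_pih_index)
    also have "\<dots> = (\<Sum>m<k. if i = m
        then \<Sum>j<q. (H (\<sigma> i) (\<pi>h l) - H (\<sigma> i) (\<pi> j)) / (\<pi>h l - \<pi> j) * \<alpha> i j else 0)"
      by (intro sum.cong) auto
    also have "\<dots> = (\<Sum>j<q. (H (\<sigma> i) (\<pi>h l) - H (\<sigma> i) (\<pi> j)) / (\<pi>h l - \<pi> j) * \<alpha> i j)"
      using that by simp
    \<comment> \<open>The constraint on \<beta> splits each divided difference into a term of
      \<open>H d\<close> and a term of \<open>n\<close>; the other two blocks are treated in the
      same way.\<close>
    also have "\<dots> = (\<Sum>j<q. H (\<sigma> i) (\<pi>h l) * (\<alpha> i j / (\<pi>h l - \<pi> j)) - \<beta> i j / (\<pi>h l - \<pi> j))"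
      using that \<beta> by (intro sum.cong) (auto simp: diff_divide_distrib algebra_simps)
    finally show ?thesis
      by (simp add: bary_sum_sigma_def sum_subtractf sum_distrib_left)
  qed
  have rowB: "(?B *\<^sub>v v) $ (ih + (N - k) * j) =
      H (\<sigma>h ih) (\<pi> j) * bary_sum_pi k \<sigma> \<alpha> j (\<sigma>h ih) - bary_sum_pi k \<sigma> \<beta> j (\<sigma>h ih)"
    if "j < q" "ih < N - k" for j ih
  proof -
    have "(?B *\<^sub>v v) $ (ih + (N - k) * j) = (\<Sum>i<k. \<Sum>n<q. if j = n
        then (H (\<sigma>h ih) (\<pi> j) - H (\<sigma> i) (\<pi> j)) / (\<sigma>h ih - \<sigma> i) * \<alpha> i j else 0)"
      unfolding index_mult_mat_vec_pairs[OF B v mult_add_less[OF that]]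
      using that \<alpha> by (intro sum.cong refl) (auto simp: loewner_sigmah_pi_index)
    also have "\<dots> = (\<Sum>i<k. (H (\<sigma>h ih) (\<pi> j) - H (\<sigma> i) (\<pi> j)) / (\<sigma>h ih - \<sigma> i) * \<alpha> i j)"
      using that by simp
    also have "\<dots> = (\<Sum>i<k. H (\<sigma>h ih) (\<pi> j) * (\<alpha> i j / (\<sigma>h ih - \<sigma> i)) - \<beta> i j / (\<sigma>h ih - \<sigma> i))"
      using that \<beta> by (intro sum.cong) (auto simp: diff_divide_distrib algebra_simps)
    finally show ?thesis
      by (simp add: bary_sum_pi_def sum_subtractf sum_distrib_left)
  qed
  have rowC: "(?C *\<^sub>v v) $ (jh + (M - q) * ih) =
      H (\<sigma>h ih) (\<pi>h jh) * bary_sum k q \<sigma> \<pi> \<alpha> (\<sigma>h ih) (\<pi>h jh) - bary_sum k q \<sigma> \<pi> \<beta> (\<sigma>h ih) (\<pi>h jh)"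
    if "ih < N - k" "jh < M - q" for ih jh
  proof -
    let ?D = "\<lambda>i j. (\<sigma>h ih - \<sigma> i) * (\<pi>h jh - \<pi> j)"
    have "(?C *\<^sub>v v) $ (jh + (M - q) * ih) =
        (\<Sum>i<k. \<Sum>j<q. (H (\<sigma>h ih) (\<pi>h jh) - H (\<sigma> i) (\<pi> j)) / ?D i j * \<alpha> i j)"
      unfolding index_mult_mat_vec_pairs[OF C v mult_add_less[OF that]]
      using that \<alpha> by (intro sum.cong refl) (auto simp: loewner_sigmah_pih_index)
    also have "\<dots> = (\<Sum>i<k. \<Sum>j<q. H (\<sigma>h ih) (\<pi>h jh) * (\<alpha> i j / ?D i j) - \<beta> i j / ?D i j)"
      using \<beta> by (intro sum.cong refl) (simp add: left_diff_distrib diff_divide_distrib)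
    finally show ?thesis
      by (simp add: bary_sum_def sum_subtractf sum_distrib_left)
  qed
  have "?A *\<^sub>v v \<in> carrier_vec (k * (M - q))" "?B *\<^sub>v v \<in> carrier_vec (q * (N - k))"
    "?C *\<^sub>v v \<in> carrier_vec ((N - k) * (M - q))"
    using A B C v by auto
  then show ?thesis
    unfolding split linearized_error_def
    \<comment> \<open>The rows of \<open>?B\<close> are grouped by \<open>j\<close> first, whereas
      the error sums over \<open>ih\<close> first; hence the swap.\<close>
    by (simp add: norm2_pairs_squared rowA rowB rowC sum.swap[of _ "{..<N - k}" "{..<q}"])
qed

text \<open>Convergence is asserted next to the value in (a), since \<open>Lim\<close> returns an
  unspecified value where no limit exists; the equation alone would not show that the singularity is
  removable.\<close>

theorem corollary3p1:
  fixes N M k q :: nat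
    and s \<sigma> \<sigma>h p \<pi> \<pi>h :: "nat \<Rightarrow> complex"
    and H :: "complex \<Rightarrow> complex \<Rightarrow> complex"
  assumes "disjoint_partition N s k \<sigma> \<sigma>h"
    and "disjoint_partition M p q \<pi> \<pi>h"
  shows
    "(\<forall>\<alpha> \<beta>.
        (\<forall>i<k. \<forall>j<q. \<alpha> i j \<noteq> 0 \<and> \<beta> i j = H (\<sigma> i) (\<pi> j) * \<alpha> i j) \<longrightarrow>
        (\<forall>i<k. \<forall>j<q.
           (bary_quot k q \<sigma> \<pi> \<alpha> \<beta> \<longlongrightarrow> bary_approx k q \<sigma> \<pi> \<alpha> \<beta> (\<sigma> i, \<pi> j))
             (at (\<sigma> i, \<pi> j) within bary_domain k q \<sigma> \<pi> \<alpha>) \<and>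
           bary_approx k q \<sigma> \<pi> \<alpha> \<beta> (\<sigma> i, \<pi> j) = H (\<sigma> i) (\<pi> j)))
     \<and>
     (\<forall>\<alpha> \<beta> a.
        (\<forall>i<k. \<forall>j<q. \<beta> i j = H (\<sigma> i) (\<pi> j) * \<alpha> i j) \<longrightarrow>
        is_arg_min (\<lambda>v. norm2 (loewner2 H N M k q \<sigma> \<sigma>h \<pi> \<pi>h *\<^sub>v v))
                   (\<lambda>v. v \<in> carrier_vec (k * q) \<and> norm2 v = 1) a \<longrightarrow>
        (\<forall>i<k. \<forall>j<q. \<alpha> i j = a $ (j + q * i)) \<longrightarrow>
        is_arg_min (\<lambda>(\<alpha>, \<beta>). linearized_error H N M k q \<sigma> \<sigma>h \<pi> \<pi>h \<alpha> \<beta>)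
                   (\<lambda>(\<alpha>, \<beta>). (\<forall>i<k. \<forall>j<q. \<beta> i j = H (\<sigma> i) (\<pi> j) * \<alpha> i j) \<and>
                             (\<Sum>i<k. \<Sum>j<q. (cmod (\<alpha> i j))\<^sup>2) = 1)
                   (\<alpha>, \<beta>))"
proof (intro conjI allI impI)
  fix \<alpha> \<beta> i j
  assume "\<forall>i<k. \<forall>j<q. \<alpha> i j \<noteq> 0 \<and> \<beta> i j = H (\<sigma> i) (\<pi> j) * \<alpha> i j" and ij: "i < k" "j < q"
  then have \<alpha>: "\<alpha> i j \<noteq> 0" and H: "\<beta> i j / \<alpha> i j = H (\<sigma> i) (\<pi> j)" by auto
  note node = disjoint_partition_inj(1)[OF assms(1)] disjoint_partition_inj(1)[OF assms(2)]
    ij \<alpha>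
  show "bary_approx k q \<sigma> \<pi> \<alpha> \<beta> (\<sigma> i, \<pi> j) = H (\<sigma> i) (\<pi> j)"
    by (simp add: bary_approx_node[where \<alpha> = \<alpha>, OF node] H)
  show "(bary_quot k q \<sigma> \<pi> \<alpha> \<beta> \<longlongrightarrow> bary_approx k q \<sigma> \<pi> \<alpha> \<beta> (\<sigma> i, \<pi> j))
      (at (\<sigma> i, \<pi> j) within bary_domain k q \<sigma> \<pi> \<alpha>)"
    using tendsto_bary_quot[where \<alpha> = \<alpha> and \<beta> = \<beta>, OF node]
    by (simp add: bary_approx_node[where \<alpha> = \<alpha>, OF node])
next
  fix \<alpha> \<beta> :: "nat \<Rightarrow> nat \<Rightarrow> complex" and a :: "complex vec"
  let ?L = "loewner2 H N M k q \<sigma> \<sigma>h \<pi> \<pi>h"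
  let ?E = "linearized_error H N M k q \<sigma> \<sigma>h \<pi> \<pi>h"
  assume \<beta>: "\<forall>i<k. \<forall>j<q. \<beta> i j = H (\<sigma> i) (\<pi> j) * \<alpha> i j"
    and min: "is_arg_min (\<lambda>v. norm2 (?L *\<^sub>v v)) (\<lambda>v. v \<in> carrier_vec (k * q) \<and> norm2 v = 1) a"
    and \<alpha>: "\<forall>i<k. \<forall>j<q. \<alpha> i j = a $ (j + q * i)"
  from min have a: "a \<in> carrier_vec (k * q)" "norm2 a = 1"
    by (auto simp: is_arg_min_def)
  have "(\<Sum>i<k. \<Sum>j<q. (cmod (\<alpha> i j))\<^sup>2) = 1"
    using norm2_pairs_squared[OF a(1)] a(2) \<alpha> by simp
  moreover have "?E \<alpha> \<beta> \<le> ?E \<alpha>' \<beta>'"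
    if \<beta>': "\<forall>i<k. \<forall>j<q. \<beta>' i j = H (\<sigma> i) (\<pi> j) * \<alpha>' i j"
      and 1: "(\<Sum>i<k. \<Sum>j<q. (cmod (\<alpha>' i j))\<^sup>2) = 1" for \<alpha>' \<beta>'
  proof -
    \<comment> \<open>Flattening the competing coefficients in the column order
      \<open>j + q * i\<close> gives a unit vector, with which the minimizer \<open>a\<close> can be
      compared.\<close>
    define b where "b = vec (k * q) (\<lambda>c. \<alpha>' (c div q) (c mod q))"
    have b: "b \<in> carrier_vec (k * q)" by (simp add: b_def)
    have \<alpha>': "\<forall>i<k. \<forall>j<q. \<alpha>' i j = b $ (j + q * i)"
      using mult_add_less[of _ k _ q] by (simp add: b_def)
    have "(norm2 b)\<^sup>2 = 1" using norm2_pairs_squared[OF b] 1 \<alpha>' by simp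
    then have "norm2 b = 1" using norm2_nonneg[of b] by (simp add: power2_eq_1_iff)
    then have "norm2 (?L *\<^sub>v a) \<le> norm2 (?L *\<^sub>v b)"
      using min b by (auto simp: is_arg_min_def not_less)
    \<comment> \<open>Squaring is monotone on nonnegative reals, so minimizing the norm also
      minimizes the squared norm, which is the error.\<close>
    then have "(norm2 (?L *\<^sub>v a))\<^sup>2 \<le> (norm2 (?L *\<^sub>v b))\<^sup>2"
      by (intro power_mono norm2_nonneg)
    then show ?thesis
      by (simp add: norm2_loewner2_squared[where \<alpha> = \<alpha>, OF \<beta> a(1) \<alpha>]
          norm2_loewner2_squared[where \<alpha> = \<alpha>', OF \<beta>' b \<alpha>'])
  qed
  ultimately show "is_arg_min (\<lambda>(\<alpha>, \<beta>). ?E \<alpha> \<beta>)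
      (\<lambda>(\<alpha>, \<beta>). (\<forall>i<k. \<forall>j<q. \<beta> i j = H (\<sigma> i) (\<pi> j) * \<alpha> i j) \<and>
                (\<Sum>i<k. \<Sum>j<q. (cmod (\<alpha> i j))\<^sup>2) = 1) (\<alpha>, \<beta>)"
    using \<beta> unfolding is_arg_min_def by (simp add: not_less split_paired_all) blast
qed

end
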